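(* For any Tychonoff space $X$, the following are equivalent: (i) $X$ is uncountable. (ii) $C_p(X)$ is not metrizable. (iii) $C_p(X)$ is injectively discretely selective. (iv) $C_p(X)$ is discretely selective. (v) $C_p(X)$ is SHD. (vi) $C_p(X)$ is WSHD.
   Context: $\mathbb N$ is the set of positive integers. A space is a nonempty topological space; Tychonoff spaces are $T_1$. $C_p(X)$ is the set of continuous real-valued functions on $X$ with the topology of pointwise convergence (uniform convergence on finite subsets of $X$). For a space $Y$: a subset $A\subseteq Y$ is closed and relatively discrete if it is closed and for every $y\in A$ there is an open $U$ with $U\cap A=\{y\}$. $Y$ is discretely selective if for every sequence $\langle U_n:n\in\mathbb N\rangle$ of nonempty open subsets of $Y$ there are $y_n\in U_n$ such that $\{y_n:n\in\mathbb N\}$ is closed and relatively discrete in $Y$; injectively discretely selective if moreover the $y_n$ can always be chosen with $n\mapsto y_n$ injective. $Y$ is SHD (selectively highly divergent) if for every such sequence there are $y_n\in U_n$ such that $\langle y_n:n\in\mathbb N\rangle$ has no convergent subsequence. $Y$ is WSHD (weakly selectively highly divergent) if for every such sequence there are an infinite $A\subseteq\mathbb N$ and $y_n\in U_n$ for $n\in A$ such that $\langle y_n:n\in A\rangle$ has no convergent subsequence. *)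

theory Defs
  imports "HOL-Analysis.Analysis"
begin

definition tychonoff_space :: "'a topology \<Rightarrow> bool" where
  "tychonoff_space X \<longleftrightarrow> topspace X \<noteq> {} \<and> t1_space X \<and> completely_regular_space X"

text \<open>
  A continuous real-valued function on \<open>X\<close> is represented by its unique extensional
  representative (it is \<open>undefined\<close> outside \<open>topspace X\<close>); \<open>subtopology\<close> intersects the
  given set with the extensional functions, which form the topspace of the product topology.
\<close>

definition Cp :: "'a topology \<Rightarrow> ('a \<Rightarrow> real) topology" where
  "Cp X = subtopology (product_topology (\<lambda>x. euclideanreal) (topspace X))
            {f. continuous_map X euclideanreal f}"

lemma topspace_Cp:
  "topspace (Cp X) = {f \<in> extensional (topspace X). continuous_map X euclideanreal f}"
  by (auto simp: Cp_def PiE_def)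

definition closed_relatively_discrete :: "'a topology \<Rightarrow> 'a set \<Rightarrow> bool" where
  "closed_relatively_discrete Y A \<longleftrightarrow>
     closedin Y A \<and> (\<forall>y\<in>A. \<exists>U. openin Y U \<and> U \<inter> A = {y})"

text \<open>Sequences are indexed by all of \<open>nat\<close>, starting at 0 instead of 1.\<close>

definition nonempty_open_seq :: "'a topology \<Rightarrow> (nat \<Rightarrow> 'a set) \<Rightarrow> bool" where
  "nonempty_open_seq Y U \<longleftrightarrow> (\<forall>n. openin Y (U n) \<and> U n \<noteq> {})"

definition discretely_selective :: "'a topology \<Rightarrow> bool" where
  "discretely_selective Y \<longleftrightarrow>
     (\<forall>U. nonempty_open_seq Y U \<longrightarrow>
        (\<exists>y. (\<forall>n. y n \<in> U n) \<and> closed_relatively_discrete Y (range y)))"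

definition injectively_discretely_selective :: "'a topology \<Rightarrow> bool" where
  "injectively_discretely_selective Y \<longleftrightarrow>
     (\<forall>U. nonempty_open_seq Y U \<longrightarrow>
        (\<exists>y. (\<forall>n. y n \<in> U n) \<and> closed_relatively_discrete Y (range y) \<and> inj y))"

text \<open>
  The subsequences of a family \<open>y\<close> indexed by an infinite set \<open>A\<close> of naturals are the
  sequences \<open>y \<circ> r\<close> with \<open>r\<close> strictly increasing and taking values in \<open>A\<close>.
  The values of \<open>y\<close> outside \<open>A\<close> are irrelevant.
\<close>

definition has_convergent_subseq_on :: "'a topology \<Rightarrow> nat set \<Rightarrow> (nat \<Rightarrow> 'a) \<Rightarrow> bool" where
  "has_convergent_subseq_on Y A y \<longleftrightarrow>
     (\<exists>r l. strict_mono r \<and> range r \<subseteq> A \<and> limitin Y (y \<circ> r) l sequentially)"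

definition SHD :: "'a topology \<Rightarrow> bool" where
  "SHD Y \<longleftrightarrow>
     (\<forall>U. nonempty_open_seq Y U \<longrightarrow>
        (\<exists>y. (\<forall>n. y n \<in> U n) \<and> \<not> has_convergent_subseq_on Y UNIV y))"

definition WSHD :: "'a topology \<Rightarrow> bool" where
  "WSHD Y \<longleftrightarrow>
     (\<forall>U. nonempty_open_seq Y U \<longrightarrow>
        (\<exists>A y. infinite A \<and> (\<forall>n\<in>A. y n \<in> U n) \<and> \<not> has_convergent_subseq_on Y A y))"

end

theory Submission
  imports Defs
begin

text \<open>
  A sequence of nonempty basic open sets of \<open>C\<^sub>p(X)\<close> restricts values on a countable set of points
  only. If \<open>X\<close> is uncountable, some point \<open>p\<close> is unrestricted, and one can choose the \<open>n\<close>-th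
  function to take the value \<open>n\<close> at \<open>p\<close>; continuity of the evaluation at \<open>p\<close> then makes the chosen
  sequence closed, discrete and without convergent subsequences. If \<open>X\<close> is countable,
  \<open>C\<^sub>p(X)\<close> is metrizable and has no isolated points, so the punctured balls around a fixed function
  defeat every selection principle.
\<close>

section \<open>Finite supports and interpolation in \<open>Cp X\<close>\<close>

text \<open>A basic box of the product topology around \<open>f\<close> constrains only finitely
  many coordinates; these form \<open>F\<close>.\<close>

lemma openin_Cp_finite_support:
  assumes "openin (Cp X) U" "f \<in> U"
  obtains F where "finite F" "F \<subseteq> topspace X"
    "\<And>g. \<lbrakk>g \<in> topspace (Cp X); \<And>x. x \<in> F \<Longrightarrow> g x = f x\<rbrakk> \<Longrightarrow> g \<in> U"
proof -
  obtain T where T: "openin (product_topology (\<lambda>x. euclideanreal) (topspace X)) T"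
    "U = T \<inter> {f. continuous_map X euclideanreal f}"
    using assms(1) by (auto simp: Cp_def openin_subtopology)
  then obtain W where W: "finite {x \<in> topspace X. W x \<noteq> topspace euclideanreal}"
    "f \<in> Pi\<^sub>E (topspace X) W" "Pi\<^sub>E (topspace X) W \<subseteq> T"
    using assms(2) unfolding openin_product_topology_alt by blast
  show thesis
  proof (rule that[OF W(1)])
    fix g
    assume g: "g \<in> topspace (Cp X)"
      "\<And>x. x \<in> {x \<in> topspace X. W x \<noteq> topspace euclideanreal} \<Longrightarrow> g x = f x"
    have "g x \<in> W x" if "x \<in> topspace X" for x
      using that g(2)[of x] W(2) by (cases "W x = UNIV") auto
    with g(1) have "g \<in> Pi\<^sub>E (topspace X) W"
      by (auto simp: topspace_Cp PiE_def)
    with g(1) W(3) T(2) show "g \<in> U"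
      by (auto simp: topspace_Cp)
  qed auto
qed

lemma continuous_map_Cp_eval:
  assumes "x \<in> topspace X"
  shows "continuous_map (Cp X) euclideanreal (\<lambda>f. f x)"
  unfolding Cp_def using assms
  by (intro continuous_map_from_subtopology continuous_map_product_projection)

text \<open>The finite set \<open>F\<close> is closed because \<open>X\<close> is T1, so complete
  regularity yields \<open>h\<close> with value 0 at \<open>p\<close> and 1 on \<open>F\<close>.
  Adding \<open>(c - f p) * (1 - h x)\<close> to \<open>f\<close> then corrects the value at
  \<open>p\<close> and changes nothing on \<open>F\<close>.\<close>

lemma Cp_interpolate:
  assumes "tychonoff_space X" "f \<in> topspace (Cp X)" "finite F" "F \<subseteq> topspace X"
    "p \<in> topspace X" "p \<notin> F"
  obtains g where "g \<in> topspace (Cp X)" "\<And>x. x \<in> F \<Longrightarrow> g x = f x" "g p = c"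
proof -
  have "closedin X F"
    using assms by (auto simp: tychonoff_space_def t1_space_closedin_finite)
  then obtain h where h: "continuous_map X (top_of_set {0..1::real}) h" "h p = 0" "h ` F \<subseteq> {1}"
    using assms unfolding tychonoff_space_def completely_regular_space_def by blast
  have [continuous_intros]: "continuous_map X euclideanreal h" "continuous_map X euclideanreal f"
    using h(1) assms(2) by (auto simp: continuous_map_in_subtopology topspace_Cp)
  \<comment> \<open>The restriction produces the extensional representative that membership in
    \<open>Cp X\<close> demands.\<close>
  define g where "g = restrict (\<lambda>x. f x + (c - f p) * (1 - h x)) (topspace X)"
  have "continuous_map X euclideanreal (\<lambda>x. f x + (c - f p) * (1 - h x))"
    by (intro continuous_intros continuous_map_add continuous_map_real_mult continuous_map_diff) auto
  then have "continuous_map X euclideanreal g"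
    by (rule continuous_map_eq) (simp add: g_def)
  then have "g \<in> topspace (Cp X)"
    by (simp add: topspace_Cp g_def)
  moreover have "g x = f x" if "x \<in> F" for x
    using that h(3) assms(4) by (auto simp: g_def)
  moreover have "g p = c"
    using h(2) assms(5) by (simp add: g_def)
  ultimately show thesis by (rule that)
qed

text \<open>Each \<open>U n\<close> tolerates any change of one of its members \<open>f n\<close>
  off a finite set \<open>F n\<close>. The union of the \<open>F n\<close> is countable, so it
  misses some \<open>p\<close>, where the value can be prescribed for all \<open>n\<close> at
  once.\<close>

lemma Cp_selection:
  assumes "tychonoff_space X" "uncountable (topspace X)" "nonempty_open_seq (Cp X) U"
  obtains p y where "p \<in> topspace X" "\<And>n. y n \<in> U n" "\<And>n. y n p = real n"
proof -
  have "\<exists>f. f \<in> U n" for n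
    using assms(3) by (auto simp: nonempty_open_seq_def)
  then obtain f where f: "\<And>n. f n \<in> U n" by metis
  have U: "openin (Cp X) (U n)" for n
    using assms(3) by (simp add: nonempty_open_seq_def)
  have "\<exists>F. finite F \<and> F \<subseteq> topspace X \<and>
      (\<forall>g \<in> topspace (Cp X). (\<forall>x\<in>F. g x = f n x) \<longrightarrow> g \<in> U n)" for n
    using openin_Cp_finite_support[OF U f, of n] by metis
  then obtain F where F: "\<And>n. finite (F n)" "\<And>n. F n \<subseteq> topspace X"
    "\<And>n g. g \<in> topspace (Cp X) \<Longrightarrow> \<forall>x\<in>F n. g x = f n x \<Longrightarrow> g \<in> U n"
    unfolding Ball_def by metis
  have "countable (\<Union>n. F n)"
    using F(1) by (simp add: countable_finite)
  then have "\<not> topspace X \<subseteq> (\<Union>n. F n)"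
    using assms(2) countable_subset by metis
  then obtain p where p: "p \<in> topspace X" "p \<notin> (\<Union>n. F n)"
    by blast
  have "\<exists>g. g \<in> U n \<and> g p = real n" for n
  proof -
    have pF: "p \<notin> F n"
      using p(2) by simp
    have "f n \<in> topspace (Cp X)"
      using f U openin_subset by blast
    then obtain g where "g \<in> topspace (Cp X)" "\<And>x. x \<in> F n \<Longrightarrow> g x = f n x" "g p = real n"
      by (rule Cp_interpolate[OF assms(1) _ F(1,2) p(1) pF]) (rule that)
    with F(3)[of g n] show ?thesis by auto
  qed
  then obtain y where "\<And>n. y n \<in> U n" "\<And>n. y n p = real n" by metis
  with p(1) show thesis by (rule that)
qed

section \<open>Sequences taking the value \<open>n\<close> at a fixed point\<close>

text \<open>Evaluation at \<open>p\<close> is continuous and carries \<open>y\<close> to the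
  naturals, of which only finitely many lie within distance 1 of a given real. The sets
  \<open>V c\<close> are the preimages of unit balls.\<close>

lemma closed_relatively_discrete_range_if_eval_of_nat:
  fixes y :: "nat \<Rightarrow> 'a \<Rightarrow> real"
  assumes "p \<in> topspace X" "range y \<subseteq> topspace (Cp X)" "\<And>n. y n p = real n"
  shows "closed_relatively_discrete (Cp X) (range y)"
proof -
  define V where "V c = {f \<in> topspace (Cp X). f p \<in> ball c 1}" for c
  have V: "openin (Cp X) (V c)" for c
    unfolding V_def by (rule openin_continuous_map_preimage[OF continuous_map_Cp_eval[OF assms(1)]]) simp
  have "Hausdorff_space (Cp X)"
    unfolding Cp_def by (intro Hausdorff_space_subtopology) (simp add: Hausdorff_space_product_topology)
  then have t1: "t1_space (Cp X)"
    by (rule Hausdorff_imp_t1_space)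
  have "openin (Cp X) (topspace (Cp X) - range y)"
  proof (subst openin_subopen, intro ballI)
    fix z assume z: "z \<in> topspace (Cp X) - range y"
    define N where "N = {n. \<bar>z p - real n\<bar> < 1}"
    have "N \<subseteq> {..nat \<lceil>z p + 1\<rceil>}"
      unfolding N_def by (auto simp: le_nat_iff) linarith
    then have "finite N"
      by (rule finite_subset) simp
    then have "closedin (Cp X) (y ` N)"
      using t1 assms(2) by (intro t1_space_closedin_finite[THEN iffD1, rule_format]) auto
    then have "openin (Cp X) (V (z p) - y ` N)"
      using V by (intro openin_diff) auto
    moreover have "z \<in> V (z p) - y ` N"
      using z by (auto simp: V_def)
    moreover have "V (z p) - y ` N \<subseteq> topspace (Cp X) - range y"
      using assms(3) by (auto simp: V_def N_def dist_real_def)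
    ultimately show "\<exists>T. openin (Cp X) T \<and> z \<in> T \<and> T \<subseteq> topspace (Cp X) - range y"
      by blast
  qed
  then have "closedin (Cp X) (range y)"
    using assms(2) by (simp add: closedin_def)
  moreover have "V (real n) \<inter> range y = {y n}" for n
  proof -
    \<comment> \<open>The unit ball around \<open>n\<close> contains no other natural number, so
      \<open>V (real n)\<close> isolates \<open>y n\<close>.\<close>
    have "m = n" if "\<bar>real n - real m\<bar> < 1" for m
      using that by linarith
    then show ?thesis
      using assms(2,3) by (fastforce simp: V_def dist_real_def)
  qed
  ultimately show ?thesis
    using V unfolding closed_relatively_discrete_def by blast
qed

text \<open>Evaluating a convergent subsequence at \<open>p\<close> would make
  \<open>real (r n)\<close> converge, although it tends to infinity.\<close>

lemma not_has_convergent_subseq_if_eval_of_nat: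
  assumes "p \<in> topspace X" "\<And>n. y n p = real n"
  shows "\<not> has_convergent_subseq_on (Cp X) A y"
proof
  assume "has_convergent_subseq_on (Cp X) A y"
  then obtain r l where r: "strict_mono r" "limitin (Cp X) (y \<circ> r) l sequentially"
    by (auto simp: has_convergent_subseq_on_def)
  have "limitin euclideanreal ((\<lambda>f. f p) \<circ> (y \<circ> r)) (l p) sequentially"
    using continuous_map_limit[OF continuous_map_Cp_eval[OF assms(1)] r(2)] by simp
  then have "(\<lambda>n. real (r n)) \<longlonglongrightarrow> l p"
    by (simp add: o_def assms(2))
  moreover have "filterlim (\<lambda>n. real (r n)) at_infinity sequentially"
    by (intro filterlim_at_top_imp_at_infinity
        filterlim_compose[OF filterlim_real_sequentially filterlim_subseq[OF r(1)]])
  ultimately show False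
    using not_tendsto_and_filterlim_at_infinity[OF sequentially_bot] by blast
qed

lemma injectively_discretely_selective_Cp:
  assumes "tychonoff_space X" "uncountable (topspace X)"
  shows "injectively_discretely_selective (Cp X)"
  unfolding injectively_discretely_selective_def
proof (intro allI impI)
  fix U assume U: "nonempty_open_seq (Cp X) U"
  obtain p y where y: "p \<in> topspace X" "\<And>n. y n \<in> U n" "\<And>n. y n p = real n"
    by (rule Cp_selection[OF assms U]) (rule that)
  then have "range y \<subseteq> topspace (Cp X)"
    using U openin_subset unfolding nonempty_open_seq_def by blast
  then have "closed_relatively_discrete (Cp X) (range y)"
    using y by (intro closed_relatively_discrete_range_if_eval_of_nat)
  moreover have "inj y"
    by (rule injI) (metis y(3) of_nat_eq_iff)
  ultimately show "\<exists>y. (\<forall>n. y n \<in> U n) \<and> closed_relatively_discrete (Cp X) (range y) \<and> inj y"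
    using y(2) by blast
qed

lemma SHD_Cp:
  assumes "tychonoff_space X" "uncountable (topspace X)"
  shows "SHD (Cp X)"
  unfolding SHD_def
proof (intro allI impI)
  fix U assume U: "nonempty_open_seq (Cp X) U"
  obtain p y where y: "p \<in> topspace X" "\<And>n. y n \<in> U n" "\<And>n. y n p = real n"
    by (rule Cp_selection[OF assms U]) (rule that)
  then have "\<not> has_convergent_subseq_on (Cp X) UNIV y"
    by (intro not_has_convergent_subseq_if_eval_of_nat)
  with y(2) show "\<exists>y. (\<forall>n. y n \<in> U n) \<and> \<not> has_convergent_subseq_on (Cp X) UNIV y"
    by blast
qed

lemma discretely_selective_if_injectively:
  "injectively_discretely_selective Y \<Longrightarrow> discretely_selective Y"
  unfolding injectively_discretely_selective_def discretely_selective_def by blast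

lemma WSHD_if_SHD: "SHD Y \<Longrightarrow> WSHD Y"
  unfolding SHD_def WSHD_def by (meson UNIV_I infinite_UNIV_nat)

section \<open>Metrizable spaces with a non-isolated point\<close>

text \<open>Punctured balls of radius \<open>1/(n+1)\<close> around \<open>z\<close> serve as
  \<open>U n\<close>. Membership is required only along \<open>r\<close>, so that the result also
  covers the partial selections of \<open>WSHD\<close>.\<close>

lemma metrizable_punctured_nbhds:
  assumes "metrizable_space Y" "z \<in> topspace Y" "\<not> openin Y {z}"
  obtains U where "nonempty_open_seq Y U" "\<And>n. z \<notin> U n"
    "\<And>y r. \<lbrakk>strict_mono r; \<And>n. y (r n) \<in> U (r n)\<rbrakk> \<Longrightarrow> limitin Y (y \<circ> r) z sequentially"
proof -
  obtain M d where Md: "Metric_space M d" and Y: "Y = Metric_space.mtopology M d"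
    using assms(1) by (auto simp: metrizable_space_def)
  interpret Metric_space M d by fact
  have z: "z \<in> M"
    using assms(2) by (simp add: Y)
  define U where "U n = mball z (inverse (real (Suc n))) - {z}" for n
  have "openin Y (U n)" for n
    unfolding U_def Y using z
    by (intro openin_diff openin_mball closedin_Hausdorff_singleton Hausdorff_space_mtopology) auto
  moreover have "U n \<noteq> {}" for n
  proof
    assume "U n = {}"
    \<comment> \<open>An empty punctured ball would make \<open>{z}\<close> itself a ball, hence
      open.\<close>
    then have "mball z (inverse (real (Suc n))) = {z}"
      using z by (auto simp: U_def)
    then show False
      using assms(3) openin_mball[of z "inverse (real (Suc n))"] by (simp add: Y)
  qed
  moreover have "limitin Y (y \<circ> r) z sequentially"
    if "strict_mono r" "\<And>n. y (r n) \<in> U (r n)" for y r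
    unfolding Y limitin_metric
  proof (intro conjI allI impI z)
    fix e :: real assume "e > 0"
    then obtain N where N: "inverse (real (Suc N)) < e"
      using reals_Archimedean by blast
    show "\<forall>\<^sub>F n in sequentially. (y \<circ> r) n \<in> M \<and> d ((y \<circ> r) n) z < e"
    proof (rule eventually_sequentiallyI)
      fix n assume "N \<le> n"
      \<comment> \<open>A strictly increasing \<open>r\<close> satisfies \<open>n \<le> r n\<close>,
        so the radii along \<open>r\<close> also shrink to 0.\<close>
      then have "N \<le> r n"
        using strict_mono_imp_increasing[OF that(1)] order_trans by blast
      then have "inverse (real (Suc (r n))) \<le> inverse (real (Suc N))"
        by simp
      with N have "inverse (real (Suc (r n))) < e"
        by (rule le_less_trans[rotated])
      with that(2)[of n] show "(y \<circ> r) n \<in> M \<and> d ((y \<circ> r) n) z < e"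
        by (auto simp: U_def commute)
    qed
  qed
  ultimately show thesis
    using that[of U] by (auto simp: nonempty_open_seq_def U_def)
qed

text \<open>Any selection from the punctured balls converges to \<open>z\<close>, so a closed range
  would have to contain \<open>z\<close>, which no \<open>U n\<close> does.\<close>

lemma not_discretely_selective_if_metrizable:
  assumes "metrizable_space Y" "z \<in> topspace Y" "\<not> openin Y {z}"
  shows "\<not> discretely_selective Y"
proof
  assume ds: "discretely_selective Y"
  obtain U where U: "nonempty_open_seq Y U" "\<And>n. z \<notin> U n"
    "\<And>y r. \<lbrakk>strict_mono r; \<And>n. y (r n) \<in> U (r n)\<rbrakk> \<Longrightarrow> limitin Y (y \<circ> r) z sequentially"
    using metrizable_punctured_nbhds[OF assms] by blast
  obtain y where y: "\<And>n. y n \<in> U n" "closedin Y (range y)"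
    using ds U(1) unfolding discretely_selective_def closed_relatively_discrete_def by blast
  have "limitin Y y z sequentially"
    using U(3)[of id y] y(1) by (simp add: strict_mono_id)
  then have "z \<in> range y"
    using y(2) by (rule limitin_closedin) auto
  with y(1) U(2) show False by fastforce
qed

lemma not_WSHD_if_metrizable:
  assumes "metrizable_space Y" "z \<in> topspace Y" "\<not> openin Y {z}"
  shows "\<not> WSHD Y"
proof
  assume wshd: "WSHD Y"
  obtain U where U: "nonempty_open_seq Y U"
    "\<And>y r. \<lbrakk>strict_mono r; \<And>n. y (r n) \<in> U (r n)\<rbrakk> \<Longrightarrow> limitin Y (y \<circ> r) z sequentially"
    using metrizable_punctured_nbhds[OF assms] by metis
  obtain A y where A: "infinite A" "\<forall>n\<in>A. y n \<in> U n" "\<not> has_convergent_subseq_on Y A y"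
    using wshd U(1) unfolding WSHD_def by blast
  \<comment> \<open>The increasing enumeration of \<open>A\<close> turns the partial selection into
    a sequence, which converges to \<open>z\<close>.\<close>
  have "strict_mono (enumerate A)" "range (enumerate A) \<subseteq> A"
    using A(1) by (auto simp: strict_mono_enumerate enumerate_in_set)
  moreover from this have "limitin Y (y \<circ> enumerate A) z sequentially"
    using A(2) by (intro U(2)) auto
  ultimately show False
    using A(3) unfolding has_convergent_subseq_on_def by blast
qed

section \<open>Metrizability and non-isolated points of \<open>Cp X\<close>\<close>

lemma metrizable_space_Cp:
  assumes "countable (topspace X)"
  shows "metrizable_space (Cp X)"
proof -
  \<comment> \<open>A product of metrizable spaces is metrizable when only countably many factors
    have more than one point; this is the set of such indices.\<close>
  have "countable {x \<in> topspace X. \<nexists>a. topspace euclideanreal \<subseteq> {a}}"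
    by (rule countable_subset[OF _ assms]) auto
  then show ?thesis
    unfolding Cp_def
    by (intro metrizable_space_subtopology)
      (auto simp: metrizable_space_product_topology metrizable_space_euclidean)
qed

text \<open>The constant functions form a continuous image of the real line in \<open>Cp X\<close>.
  If the zero function were isolated, its preimage \<open>{0}\<close> would be open in the
  reals.\<close>

lemma Cp_not_isolated:
  assumes "topspace X \<noteq> {}"
  obtains z where "z \<in> topspace (Cp X)" "\<not> openin (Cp X) {z}"
proof -
  define k where "k c = restrict (\<lambda>_. c :: real) (topspace X)" for c
  have cont: "continuous_map X euclideanreal (k c)" for c
    by (rule continuous_map_eq[of _ _ "\<lambda>_. c"]) (auto simp: k_def)
  have k: "continuous_map euclideanreal (Cp X) k"
    unfolding Cp_def continuous_map_in_subtopology continuous_map_componentwise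
    using cont by (auto simp: k_def)
  \<comment> \<open>Distinct constants differ at any point of the nonempty space
    \<open>X\<close>.\<close>
  have eq: "{c. k c = k 0} = {0}"
    using assms by (auto simp: k_def fun_eq_iff restrict_def split: if_splits)
  have "\<not> openin (Cp X) {k 0}"
  proof
    assume "openin (Cp X) {k 0}"
    then have "open {c. k c = k 0}"
      using openin_continuous_map_preimage[OF k, of "{k 0}"] by simp
    then show False
      by (simp add: eq not_open_singleton)
  qed
  moreover have "k 0 \<in> topspace (Cp X)"
    using cont by (simp add: topspace_Cp k_def)
  ultimately show thesis by (intro that[of "k 0"])
qed

theorem corollary3p39:
  fixes X :: "'a topology"
  assumes "tychonoff_space X"
  shows "(uncountable (topspace X) \<longleftrightarrow> \<not> metrizable_space (Cp X)) \<and>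
         (uncountable (topspace X) \<longleftrightarrow> injectively_discretely_selective (Cp X)) \<and>
         (uncountable (topspace X) \<longleftrightarrow> discretely_selective (Cp X)) \<and>
         (uncountable (topspace X) \<longleftrightarrow> SHD (Cp X)) \<and>
         (uncountable (topspace X) \<longleftrightarrow> WSHD (Cp X))"
proof -
  have "topspace X \<noteq> {}"
    using assms by (simp add: tychonoff_space_def)
  then obtain z where z: "z \<in> topspace (Cp X)" "\<not> openin (Cp X) {z}"
    by (rule Cp_not_isolated)
  note not_DS = not_discretely_selective_if_metrizable[OF _ z]
    and not_WSHD = not_WSHD_if_metrizable[OF _ z]
  show ?thesis
  proof (cases "countable (topspace X)")
    case True
    then have "metrizable_space (Cp X)"
      by (rule metrizable_space_Cp)
    then have "\<not> discretely_selective (Cp X)" "\<not> WSHD (Cp X)"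
      by (simp_all add: not_DS not_WSHD)
    with True \<open>metrizable_space (Cp X)\<close> show ?thesis
      by (auto dest: discretely_selective_if_injectively WSHD_if_SHD)
  next
    case False
    then have ids: "injectively_discretely_selective (Cp X)" and shd: "SHD (Cp X)"
      using assms by (simp_all add: injectively_discretely_selective_Cp SHD_Cp)
    have ds: "discretely_selective (Cp X)"
      using ids by (rule discretely_selective_if_injectively)
    \<comment> \<open>Non-metrizability comes by contraposition: a metrizable \<open>Cp X\<close>
      with the non-isolated point \<open>z\<close> could not be discretely selective.\<close>
    then have "\<not> metrizable_space (Cp X)"
      using not_DS by metis
    with False ids ds shd WSHD_if_SHD[OF shd] show ?thesis
      by simp
  qed
qed

end
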